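(* Let $\mathbb{K}$ be a field and let $P=\begin{pmatrix}P_1&P_2\\P_3&P_4\end{pmatrix}\in GL_{m+n}(\mathbb{K})$ be partitioned so that $P_1$ is $m\times m$ (hence $P_4$ is $n\times n$). Let $p_i=\operatorname{rk}P_i$ for $i=1,2,3,4$. Let $(l,r)\in\mathbb{N}^2$ satisfy $l\ge n-p_4$, $r\ge m-p_1$, and $$r+l=\max(p_3,\;n+m-p_4-p_1).$$ Then there exist matrices $L,R\in\mathbb{K}^{n\times m}$, $C_1\in\mathbb{K}^{m\times m}$, $C_2\in\mathbb{K}^{m\times n}$, $C_4\in\mathbb{K}^{n\times n}$ such that $$P=\begin{pmatrix}I_m&0\\L&I_n\end{pmatrix}\begin{pmatrix}C_1&C_2\\0&C_4\end{pmatrix}\begin{pmatrix}I_m&0\\R&I_n\end{pmatrix},$$ with $\operatorname{rk}L=l$ and $\operatorname{rk}R=r$.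
   Context: $I_k$ denotes the $k\times k$ identity matrix, $\operatorname{rk}$ denotes matrix rank, and $\mathbb{N}$ is the set of nonnegative integers. *)

theory Defs
  imports "Jordan_Normal_Form.DL_Rank"
begin

(* vec_space.rank takes the ambient dimension (the number of rows, as it is a
   column rank) as an explicit parameter; here it is read off the matrix. *)
definition rk :: "'a::field mat \<Rightarrow> nat" where
  "rk A = vec_space.rank (dim_row A) A"

end

theory Submission
  imports Defs
begin

text \<open>
Multiplying out the three factors, the factorization exists for given \<open>L\<close> and \<open>R\<close> exactly when
\<open>P3 = L P1 + (P4 - L P2) R\<close>; then \<open>C1 = P1 - P2 R\<close>, \<open>C2 = P2\<close> and \<open>C4 = P4 - L P2\<close>, and \<open>C1\<close>, \<open>C4\<close> are
invertible because \<open>P\<close> is. Invertibility forces \<open>rk L \<ge> n - rk P4\<close> and \<open>rk R \<ge> m - rk P1\<close>, and the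
equation forces \<open>rk L + rk R \<ge> rk P3\<close>. As \<open>r + l\<close> is the least sum compatible with these bounds, it
suffices to solve the equation with \<open>rk L \<le> l\<close> and \<open>rk R \<le> r\<close> (\<open>low_rank_shears_exist\<close>).

The matrix \<open>L\<close> is built from rank-one pieces. Subtracting \<open>u v\<close> (a column times a row) times the upper
block row from the lower one replaces \<open>P3\<close> by \<open>P3 - u v P1\<close> and \<open>P4\<close> by \<open>P4 - u v P2\<close> and uses up one
unit of \<open>l\<close>. Such a step has two duties: to raise \<open>rk P4\<close> if \<open>P4\<close> is singular, and to lower \<open>rk P3\<close> if
\<open>rk P3 > m - rk P1\<close>; when the latter fails, \<open>rk P3 \<le> r\<close> holds anyway. After \<open>l\<close> steps \<open>P4\<close> is invertible
and \<open>rk P3 \<le> r\<close>, and the inverse of \<open>P4\<close> times \<open>P3\<close> can serve as \<open>R\<close>.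

That one step can perform both duties at once is the heart of the proof
(\<open>shear_improves_both_blocks\<close>, \<open>shear_keeps_corner_invertible\<close>). By Wedderburn's rank reduction
(\<open>rk_wedderburn\<close>), \<open>u v P1\<close> lowers \<open>rk P3\<close> if \<open>u = P3 y\<close>, \<open>v P1\<close> lies in the row space of \<open>P3\<close> and
\<open>v P1 y = 1\<close>; a suitable \<open>v\<close> with \<open>v P1 \<noteq> 0\<close> exists because the row spaces of \<open>P1\<close> and \<open>P3\<close> meet
nontrivially if \<open>rk P1 + rk P3 > m\<close> (\<open>row_spaces_meet\<close>). The effect on \<open>P4\<close> asks in addition that \<open>v\<close>
and \<open>y\<close> each avoid one more proper subspace. Two proper subspaces never cover a vector space, over any
field, so suitable \<open>v\<close> and \<open>y\<close> exist.
\<close>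

section \<open>Matrix identities without explicit dimensions\<close>

text \<open>The distributive and associative laws are restated here with side conditions about dimensions instead
of membership in carrier sets. Every intermediate dimension is then determined by the term itself, so
the laws work as conditional rewrite rules that expand products into sums of right-nested products.
Remaining additive identities are checked entrywise, with the rule for entries of products switched off
so that products stay atomic.\<close>

lemma mat_assoc:
  assumes "dim_col A = dim_row B" "dim_col B = dim_row C"
  shows "(A :: 'a::field mat) * B * C = A * (B * C)"
  by (rule assoc_mult_mat[of _ "dim_row A" "dim_col A" _ "dim_col B" _ "dim_col C"];
      rule carrier_matI; simp add: assms)

lemma mat_distrib:
  fixes A B C :: "'a::field mat"
  shows "\<lbrakk>dim_row A = dim_row B; dim_col A = dim_col B; dim_col B = dim_row C\<rbrakk>
      \<Longrightarrow> (A + B) * C = A * C + B * C"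
    and "\<lbrakk>dim_col A = dim_row B; dim_row B = dim_row C; dim_col B = dim_col C\<rbrakk>
      \<Longrightarrow> A * (B + C) = A * B + A * C"
    and "\<lbrakk>dim_row A = dim_row B; dim_col A = dim_col B; dim_col B = dim_row C\<rbrakk>
      \<Longrightarrow> (A - B) * C = A * C - B * C"
    and "\<lbrakk>dim_col A = dim_row B; dim_row B = dim_row C; dim_col B = dim_col C\<rbrakk>
      \<Longrightarrow> A * (B - C) = A * B - A * C"
  by (rule add_mult_distrib_mat mult_add_distrib_mat minus_mult_distrib_mat
        mult_minus_distrib_mat; rule carrier_matI; simp)+

lemma mat_smult:
  fixes A B :: "'a::field mat"
  shows "dim_col A = dim_row B \<Longrightarrow> (c \<cdot>\<^sub>m A) * B = c \<cdot>\<^sub>m (A * B)"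
    and "dim_col A = dim_row B \<Longrightarrow> A * (c \<cdot>\<^sub>m B) = c \<cdot>\<^sub>m (A * B)"
  by (rule mult_smult_assoc_mat mult_smult_distrib; rule carrier_matI; simp)+

lemma mat_unit:
  fixes A :: "'a::field mat"
  shows "dim_row A = n \<Longrightarrow> 1\<^sub>m n * A = A" and "dim_col A = n \<Longrightarrow> A * 1\<^sub>m n = A"
    and "dim_row A = n \<Longrightarrow> 0\<^sub>m k n * A = 0\<^sub>m k (dim_col A)"
    and "dim_col A = n \<Longrightarrow> A * 0\<^sub>m n k = 0\<^sub>m (dim_row A) k"
  by (rule left_mult_one_mat right_mult_one_mat left_mult_zero_mat right_mult_zero_mat;
      rule carrier_matI; simp)+

lemma minus_mat_eq_zero_imp_eq:
  fixes A B :: "'a::field mat"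
  assumes "A \<in> carrier_mat n m" "B \<in> carrier_mat n m" "A - B = 0\<^sub>m n m"
  shows "A = B"
proof (rule eq_matI)
  fix i j assume "i < dim_row B" "j < dim_col B"
  then show "A $$ (i, j) = B $$ (i, j)"
    using arg_cong[OF assms(3), of "\<lambda>M. M $$ (i, j)"] assms(1,2) by simp
qed (use assms(1,2) in simp_all)

lemmas mat_ring = mat_assoc mat_distrib mat_smult mat_unit

section \<open>Rank through factorizations\<close>

text \<open>A maximal independent set of columns spans all columns: its members form \<open>B\<close>, the coordinates form
\<open>C\<close>. Together with \<open>rk_le_inner_dim\<close> this identifies the rank with the least inner dimension of a
factorization, a description that treats rows and columns alike; most rank inequalities below are
obtained by factoring.\<close>

lemma rank_factorization:
  fixes A :: "'a::field mat"
  assumes "A \<in> carrier_mat n m"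
  obtains B C where "B \<in> carrier_mat n (rk A)" "C \<in> carrier_mat (rk A) m" "A = B * C"
proof -
  interpret V: vec_space "TYPE('a)" n .
  have A_cols: "set (cols A) \<subseteq> carrier_vec n"
    using assms cols_dim by blast
  have "V.lin_indpt {}"
    by (rule V.finite_lin_indpt2) auto
  then obtain S where S: "maximal S (\<lambda>T. T \<subseteq> set (cols A) \<and> V.lin_indpt T)" "finite S"
    using maximal_exists_superset[of "set (cols A)" "\<lambda>T. T \<subseteq> set (cols A) \<and> V.lin_indpt T" "{}"]
    by auto
  then have S_sub: "S \<subseteq> set (cols A)" and S_ind: "V.lin_indpt S"
    by (auto simp: maximal_def)
  have card: "rk A = card S"
    using V.rank_card_indpt[OF assms S(1)] assms by (simp add: rk_def)
  have in_span: "c \<in> V.span S" if c: "c \<in> set (cols A)" for c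
  proof (rule ccontr)
    assume nin: "c \<notin> V.span S"
    have "c \<notin> S"
      using nin V.span_mem[of S c] S_sub A_cols by auto
    then have "V.lin_indpt (S \<union> {c})"
      using V.lin_dep_iff_in_span[of S c] nin S_ind S_sub A_cols c
      by (auto simp: module_vec_simps)
    then show False
      using S(1) \<open>c \<notin> S\<close> c S_sub unfolding maximal_def by blast
  qed
  obtain us where us: "set us = S" "distinct us"
    using finite_distinct_list[OF S(2)] by auto
  define B where "B = mat_of_cols n us"
  have len: "length us = rk A"
    using us card distinct_card by fastforce
  have B: "B \<in> carrier_mat n (rk A)"
    by (simp add: B_def len[symmetric])
  have "V.span S = V.col_space B"
    using us S_sub A_cols by (simp add: V.col_space_def B_def cols_mat_of_cols subset_trans)
  then have "\<exists>x\<in>carrier_vec (rk A). B *\<^sub>v x = col A j" if "j < m" for j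
    using V.col_space_eq[OF B] B in_span[of "col A j"] that assms by (auto simp: cols_def)
  then obtain x where x: "\<And>j. j < m \<Longrightarrow> x j \<in> carrier_vec (rk A) \<and> B *\<^sub>v x j = col A j"
    by metis
  define C where "C = mat_of_cols (rk A) (map x [0..<m])"
  have C: "C \<in> carrier_mat (rk A) m"
    by (simp add: C_def mat_of_cols_def)
  have "A = B * C"
  proof (rule eq_matI)
    fix i j assume ij: "i < dim_row (B * C)" "j < dim_col (B * C)"
    then have i: "i < n" and j: "j < m" using B C by auto
    have "A $$ (i, j) = (B *\<^sub>v x j) $ i"
      using x[OF j] i j assms by auto
    also have "x j = col C j"
      using x[OF j] j by (simp add: C_def)
    finally show "A $$ (i, j) = (B * C) $$ (i, j)"
      using i j B C by simp
  qed (use assms B C in auto)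
  then show thesis using that B C by blast
qed

lemma rk_le_inner_dim:
  assumes "B \<in> carrier_mat n k" "C \<in> carrier_mat k m"
  shows "rk (B * C :: 'a::field mat) \<le> k"
proof -
  interpret V: vec_space "TYPE('a)" n .
  have BC: "B * C \<in> carrier_mat n m" using assms by simp
  have sub: "V.col_space (B * C) \<subseteq> V.col_space B"
    using assms by (auto simp: V.col_space_eq[OF BC] V.col_space_eq[OF assms(1)]
        intro!: bexI[of _ "C *\<^sub>v _"])
  have cols: "set (cols B) \<subseteq> carrier_vec n" "set (cols (B * C)) \<subseteq> carrier_vec n"
    using cols_dim assms(1) BC by blast+
  have sB: "subspace class_ring (V.col_space B) V.V"
    and sBC: "subspace class_ring (V.col_space (B * C)) V.V"
    unfolding V.col_space_def using cols V.span_is_subspace by auto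
  have "V.rank (B * C) \<le> V.rank B"
    unfolding V.rank_def V.col_space_def[symmetric]
    using vectorspace.subspace_dim[OF V.subspace_is_vs[OF sB] V.nested_subspaces[OF sB sBC sub]]
      V.fin_dim_span_cols[OF assms(1)] V.fin_dim_span_cols[OF BC]
    by (simp add: V.col_space_def)
  also have "\<dots> \<le> k" by (rule V.rank_le_nc[OF assms(1)])
  finally show ?thesis using assms by (simp add: rk_def)
qed

lemma rk_mult_le:
  fixes A B :: "'a::field mat"
  assumes "A \<in> carrier_mat n k" "B \<in> carrier_mat k m"
  shows "rk (A * B) \<le> rk A" and "rk (A * B) \<le> rk B"
proof -
  obtain F G where F: "F \<in> carrier_mat n (rk A)" "G \<in> carrier_mat (rk A) k" "A = F * G"
    by (rule rank_factorization[OF assms(1)])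
  have "A * B = F * (G * B)" using F assms by (simp add: mat_ring)
  then show "rk (A * B) \<le> rk A"
    using rk_le_inner_dim[of F n "rk A" "G * B" m] F(1,2) assms by simp
next
  obtain F G where F: "F \<in> carrier_mat k (rk B)" "G \<in> carrier_mat (rk B) m" "B = F * G"
    by (rule rank_factorization[OF assms(2)])
  have "A * B = (A * F) * G" using F(1,2) assms unfolding F(3) by (simp add: mat_ring)
  then show "rk (A * B) \<le> rk B"
    using rk_le_inner_dim[of "A * F" n "rk B" G m] F(1,2) assms by simp
qed

lemma rk_add_le:
  assumes "A \<in> carrier_mat n m" "B \<in> carrier_mat n m"
  shows "rk (A + B) \<le> rk A + rk (B :: 'a::field mat)"
  using vec_space.rank_subadditive[OF assms] assms by (simp add: rk_def)

lemma rk_zero: "rk (0\<^sub>m n m :: 'a::field mat) = 0"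
  by (simp add: rk_def vec_space.rank_0I)

lemma rk_eq_dim_iff_det:
  "A \<in> carrier_mat n n \<Longrightarrow> rk A = n \<longleftrightarrow> det (A :: 'a::field mat) \<noteq> 0"
  by (simp add: rk_def vec_space.det_rank_iff)

lemma rk_one: "rk (1\<^sub>m n :: 'a::field mat) = n"
  by (simp add: rk_eq_dim_iff_det[of _ n])

lemma rk_le_dim: 
  assumes "A \<in> carrier_mat n m" shows "rk (A :: 'a::field mat) \<le> n" "rk A \<le> m"
  using rk_le_inner_dim[of "1\<^sub>m n" n n A m] rk_le_inner_dim[of A n m "1\<^sub>m m" m] assms
  by (simp_all add: mat_ring)

lemma rk_outer_product_le: 
  "u \<in> carrier_mat n 1 \<Longrightarrow> w \<in> carrier_mat 1 m \<Longrightarrow> rk (u * w :: 'a::field mat) \<le> 1"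
  by (rule rk_le_inner_dim)

lemma singular_imp_right_kernel:
  fixes A :: "'a::field mat"
  assumes "A \<in> carrier_mat n n" "rk A < n"
  obtains z where "z \<in> carrier_mat n 1" "z \<noteq> 0\<^sub>m n 1" "A * z = 0\<^sub>m n 1"
proof -
  have "det A = 0" using rk_eq_dim_iff_det[OF assms(1)] assms(2) by auto
  then obtain v where v: "v \<in> carrier_vec n" "v \<noteq> 0\<^sub>v n" "A *\<^sub>v v = 0\<^sub>v n"
    using det_0_iff_vec_prod_zero_field[OF assms(1)] by auto
  let ?z = "mat_of_cols n [v]"
  have "?z \<in> carrier_mat n 1" by (rule carrier_matI) simp_all
  moreover have "?z \<noteq> 0\<^sub>m n 1"
  proof
    assume "?z = 0\<^sub>m n 1"
    then have "col ?z 0 = col (0\<^sub>m n 1) 0" by simp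
    then show False using v by simp
  qed
  moreover have "A * ?z = 0\<^sub>m n 1"
  proof (rule eq_matI)
    fix i j assume "i < dim_row (0\<^sub>m n 1 :: 'a mat)" "j < dim_col (0\<^sub>m n 1 :: 'a mat)"
    then have i: "i < n" and j: "j = 0" by simp_all
    have "(A * ?z) $$ (i, j) = (A *\<^sub>v v) $ i"
      using i j assms(1) v(1) by simp
    then show "(A * ?z) $$ (i, j) = 0\<^sub>m n 1 $$ (i, j)"
      using i j v(3) by simp
  qed (use assms(1) in simp_all)
  ultimately show thesis using that by blast
qed

lemma singular_imp_left_kernel:
  fixes A :: "'a::field mat"
  assumes "A \<in> carrier_mat n n" "rk A < n"
  obtains g where "g \<in> carrier_mat 1 n" "g \<noteq> 0\<^sub>m 1 n" "g * A = 0\<^sub>m 1 n"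
proof -
  have AT: "A\<^sup>T \<in> carrier_mat n n" using assms(1) by simp
  have "rk A\<^sup>T < n"
    using rk_eq_dim_iff_det[OF assms(1)] rk_eq_dim_iff_det[OF AT] rk_le_dim(1)[OF AT]
      det_transpose[OF assms(1)] assms(2) by auto
  then obtain z where z: "z \<in> carrier_mat n 1" "z \<noteq> 0\<^sub>m n 1" "A\<^sup>T * z = 0\<^sub>m n 1"
    by (rule singular_imp_right_kernel[OF AT])
  have "z\<^sup>T * A = (A\<^sup>T * z)\<^sup>T"
    using transpose_mult[of "A\<^sup>T" n n z 1] z assms by simp
  then show thesis
    using that[of "z\<^sup>T"] z(1,3) transpose_transpose[of z] z(2) by fastforce
qed

section \<open>Rank-one corrections that change the rank\<close>

lemma obtain_unit_entry:
  fixes A :: "'a::field mat"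
  assumes A: "A \<in> carrier_mat n m" and nz: "A \<noteq> 0\<^sub>m n m"
  obtains g z where "g \<in> carrier_mat 1 n" "z \<in> carrier_mat m 1" "g * A * z = 1\<^sub>m 1"
proof -
  obtain i j where ij: "i < n" "j < m" "A $$ (i, j) \<noteq> 0"
    using A nz by (metis carrier_matD eq_matI index_zero_mat)
  define g where "g = mat 1 n (\<lambda>(_, k). if k = i then inverse (A $$ (i, j)) else 0)"
  define z where "z = mat m 1 (\<lambda>(k, _). if k = j then 1 else 0 :: 'a)"
  have gz: "g \<in> carrier_mat 1 n" "z \<in> carrier_mat m 1"
    by (simp_all add: g_def z_def)
  have "(g * A) $$ (0, k) = inverse (A $$ (i, j)) * A $$ (i, k)" if "k < m" for k
    using that A ij(1) by (simp add: g_def scalar_prod_def if_distrib[of "\<lambda>x. x * _"] cong: if_cong)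
  then have "(g * A * z) $$ (0, 0) = inverse (A $$ (i, j)) * A $$ (i, j)"
    using A gz(1) ij(2) by (simp add: z_def scalar_prod_def if_distrib[of "\<lambda>x. _ * x"] cong: if_cong)
  then have "g * A * z = 1\<^sub>m 1"
    using gz ij(3) by (intro eq_matI) simp_all
  then show thesis using that gz by blast
qed

lemma zero_neq_one_mat: "0\<^sub>m 1 1 \<noteq> (1\<^sub>m 1 :: 'a::field mat)"
proof
  assume "0\<^sub>m 1 1 = (1\<^sub>m 1 :: 'a mat)"
  from arg_cong[OF this, of "\<lambda>M. M $$ (0, 0)"] show False by simp
qed

lemma scalar_mat_inverse:
  fixes c :: "'a::field mat"
  assumes "c \<in> carrier_mat 1 1" "c \<noteq> 0\<^sub>m 1 1"
  obtains k where "k \<cdot>\<^sub>m c = 1\<^sub>m 1"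
proof -
  have "c $$ (0, 0) \<noteq> 0"
  proof
    assume "c $$ (0, 0) = 0"
    then have "c = 0\<^sub>m 1 1" using assms(1) by (intro eq_matI) auto
    then show False using assms(2) by simp
  qed
  then have "inverse (c $$ (0, 0)) \<cdot>\<^sub>m c = 1\<^sub>m 1"
    using assms(1) by (intro eq_matI) auto
  then show thesis by (rule that)
qed

text \<open>Wedderburn's rank reduction. In a rank factorization \<open>A = F G\<close> the correction acts in the middle:
\<open>A - A z g A = F E G\<close> where \<open>E = 1 - (G z) (g F)\<close> is a square matrix of size \<open>rk A\<close>. By the
normalization \<open>g A z = 1\<close>, \<open>E\<close> kills the nonzero vector \<open>G z\<close>, so its rank is too small.\<close>

lemma rk_wedderburn:
  fixes A :: "'a::field mat"
  assumes A: "A \<in> carrier_mat n m" and g: "g \<in> carrier_mat 1 n" and z: "z \<in> carrier_mat m 1"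
    and one: "g * A * z = 1\<^sub>m 1"
  shows "rk (A - A * z * (g * A)) < rk A"
proof -
  obtain F G where F: "F \<in> carrier_mat n (rk A)" "G \<in> carrier_mat (rk A) m" and FG: "A = F * G"
    by (rule rank_factorization[OF A])
  define r where "r = rk A"
  note [simp] = carrier_matD[OF F(1), folded r_def] carrier_matD[OF F(2), folded r_def]
    carrier_matD[OF g] carrier_matD[OF z]
  define E where "E = 1\<^sub>m r - G * z * (g * F)"
  have E: "E \<in> carrier_mat r r" by (simp add: E_def carrier_matI)
  have Gz: "G * z \<in> carrier_mat r 1" by (rule carrier_matI) simp_all
  have one': "g * (F * (G * z)) = 1\<^sub>m 1"
    using one unfolding FG by (simp add: mat_ring)
  have "E * (G * z) = G * z - G * z"
    by (simp add: E_def mat_ring one')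
  then have kill: "E * (G * z) = 0\<^sub>m r 1"
    using minus_r_inv_mat[OF Gz] by simp
  have "G * z \<noteq> 0\<^sub>m r 1"
  proof
    assume "G * z = 0\<^sub>m r 1"
    then have "g * (F * (G * z)) = 0\<^sub>m 1 1" by (simp add: mat_ring)
    then show False using one' zero_neq_one_mat by metis
  qed
  have "rk E \<noteq> r"
  proof
    assume "rk E = r"
    then have "det E \<noteq> 0" using rk_eq_dim_iff_det[OF E] by simp
    then obtain W where "W \<in> carrier_mat r r" "W * E = 1\<^sub>m r"
      using det_non_zero_imp_unit[OF E, of "()"] by (auto simp: Units_def ring_mat_def)
    then have "G * z = W * (E * (G * z))"
      using E Gz by (metis assoc_mult_mat left_mult_one_mat)
    then show False
      using \<open>G * z \<noteq> 0\<^sub>m r 1\<close> kill \<open>W \<in> carrier_mat r r\<close> by simp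
  qed
  then have "rk E < r" using rk_le_dim(1)[OF E] by simp
  have "A - A * z * (g * A) = F * (E * G)"
    unfolding FG E_def by (simp add: mat_ring)
  moreover have "rk (F * (E * G)) \<le> rk (E * G)"
    using rk_mult_le(2)[of F n r "E * G" m] F E by (simp add: r_def)
  moreover have "rk (E * G) \<le> rk E"
    using rk_mult_le(1)[of E r r G m] F E by (simp add: r_def)
  ultimately show ?thesis using \<open>rk E < r\<close> by (simp add: r_def)
qed

text \<open>Here \<open>u\<close> lies outside the column space of \<open>A\<close> (a left kernel vector \<open>g\<close> detects it) and \<open>w\<close> outside
the row space. Scaled so that \<open>g u = 1\<close> and \<open>w z = -1\<close>, the matrix \<open>B = A - u w\<close> has \<open>B z = u\<close> and
\<open>g B = -w\<close>, hence \<open>A = B - B z g B\<close> arises from \<open>B\<close> by a Wedderburn reduction.\<close>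

lemma rk_wedderburn_converse:
  fixes A :: "'a::field mat"
  assumes A: "A \<in> carrier_mat n m" and u: "u \<in> carrier_mat n 1" and w: "w \<in> carrier_mat 1 m"
    and g: "g \<in> carrier_mat 1 n" "g * A = 0\<^sub>m 1 m" "g * u \<noteq> 0\<^sub>m 1 1"
    and z: "z \<in> carrier_mat m 1" "A * z = 0\<^sub>m n 1" "w * z \<noteq> 0\<^sub>m 1 1"
  shows "rk A < rk (A - u * w)"
proof -
  note [simp] = carrier_matD[OF A] carrier_matD[OF u] carrier_matD[OF w] carrier_matD[OF g(1)]
    carrier_matD[OF z(1)]
  have "g * u \<in> carrier_mat 1 1" "w * z \<in> carrier_mat 1 1" by (simp_all add: carrier_matI)
  then obtain a b where a: "a \<cdot>\<^sub>m (g * u) = 1\<^sub>m 1" and b: "b \<cdot>\<^sub>m (w * z) = 1\<^sub>m 1"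
    using scalar_mat_inverse g(3) z(3) by metis
  define h where "h = a \<cdot>\<^sub>m g"
  define y where "y = (- b) \<cdot>\<^sub>m z"
  have [simp]: "dim_row h = 1" "dim_col h = n" "dim_row y = m" "dim_col y = 1"
    by (simp_all add: h_def y_def)
  define B where "B = A - u * w"
  have [simp]: "dim_row B = n" "dim_col B = m" by (simp_all add: B_def)
  have hu: "h * u = 1\<^sub>m 1" using a by (simp add: h_def mat_ring)
  have wy: "w * y = - 1\<^sub>m 1"
  proof -
    have "w * y = - (b \<cdot>\<^sub>m (w * z))" by (intro eq_matI) (simp_all add: y_def mat_ring)
    then show ?thesis by (simp only: b)
  qed
  have hA: "h * A = 0\<^sub>m 1 m" using g(2) by (simp add: h_def mat_ring)
  have Ay: "A * y = 0\<^sub>m n 1" using z(2) by (simp add: y_def mat_ring)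
  have By: "B * y = u"
  proof -
    have "B * y = A * y - u * (w * y)" by (simp add: B_def mat_ring)
    also have "\<dots> = u" unfolding Ay wy by (intro eq_matI) auto
    finally show ?thesis .
  qed
  have hB: "h * B = - w"
  proof -
    have "h * B = h * A - (h * u) * w" by (simp add: B_def mat_ring)
    also have "\<dots> = - w" unfolding hA hu by (intro eq_matI) (simp_all add: mat_ring)
    finally show ?thesis .
  qed
  have "rk (B - B * y * (h * B)) < rk B"
  proof (rule rk_wedderburn[of B n m])
    show "h * B * y = 1\<^sub>m 1"
    proof -
      have "h * B * y = h * (B * y)" by (simp add: mat_ring)
      then show ?thesis by (simp add: By hu)
    qed
  qed (simp_all add: carrier_matI)
  moreover have "B - B * y * (h * B) = A"
    unfolding By hB by (intro eq_matI) (auto simp: B_def)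
  ultimately show ?thesis by (simp add: B_def)
qed

section \<open>Matrices whose product vanishes\<close>

text \<open>A projection-like matrix \<open>N = 1 - B X\<close> that kills \<open>B\<close> and is as small as this allows. Among the \<open>X\<close> with
\<open>rk N + rk (B X) \<le> p\<close> (\<open>X = 0\<close> is one) take one with \<open>rk N\<close> minimal. If \<open>N B\<close> were nonzero, a Wedderburn
reduction of \<open>N\<close> along a column of \<open>N B\<close> would lower \<open>rk N\<close>; it again has the form \<open>1 - B Y\<close>, and
\<open>B Y\<close> differs from \<open>B X\<close> by rank one, so \<open>Y\<close> would contradict minimality. Once \<open>N B = 0\<close>, we have
\<open>B = B X B\<close> and hence \<open>rk B \<le> rk (B X)\<close>.\<close>

lemma left_annihilator:
  fixes B :: "'a::field mat"
  assumes B: "B \<in> carrier_mat p b"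
  obtains X where "X \<in> carrier_mat b p" "(1\<^sub>m p - B * X) * B = 0\<^sub>m p b"
    "rk (1\<^sub>m p - B * X) + rk B \<le> p"
proof -
  note [simp] = carrier_matD[OF B]
  define good where "good X \<longleftrightarrow> X \<in> carrier_mat b p \<and> rk (1\<^sub>m p - B * X) + rk (B * X) \<le> p" for X
  define N where "N X = 1\<^sub>m p - B * X" for X
  have "1\<^sub>m p - B * 0\<^sub>m b p = 1\<^sub>m p" by (intro eq_matI) (auto simp: mat_ring)
  then have "good (0\<^sub>m b p)"
    by (simp add: good_def mat_ring rk_one rk_zero)
  then obtain X where X: "good X" and min: "\<And>Y. good Y \<Longrightarrow> rk (N X) \<le> rk (N Y)"
    using ex_has_least_nat[of good "0\<^sub>m b p" "\<lambda>Y. rk (N Y)"] by auto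
  then have Xc: "X \<in> carrier_mat b p" and Xr: "rk (N X) + rk (B * X) \<le> p"
    by (auto simp: good_def N_def)
  note [simp] = carrier_matD[OF Xc]
  have Nc: "N X \<in> carrier_mat p p" by (simp add: N_def carrier_matI)
  note [simp] = carrier_matD[OF Nc]
  have NB: "N X * B = 0\<^sub>m p b"
  proof (rule ccontr)
    assume nz: "N X * B \<noteq> 0\<^sub>m p b"
    have "N X * B \<in> carrier_mat p b" using Nc B by simp
    then obtain g z where gz: "g \<in> carrier_mat 1 p" "z \<in> carrier_mat b 1" "g * (N X * B) * z = 1\<^sub>m 1"
      using obtain_unit_entry nz by metis
    note [simp] = carrier_matD[OF gz(1)] carrier_matD[OF gz(2)]
    \<comment> \<open>chosen such that \<open>1 - B Y = N X - (N X) B z g (N X)\<close>\<close>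
    define Y where "Y = X + (z - X * (B * z)) * (g * N X)"
    have Yc: "Y \<in> carrier_mat b p" by (simp add: Y_def carrier_matI)
    have BY: "B * Y = B * X + N X * (B * z) * (g * N X)"
    proof -
      have "B * Y = B * X + (B * z - B * (X * (B * z))) * (g * N X)"
        by (simp add: Y_def mat_ring)
      also have "B * z - B * (X * (B * z)) = N X * (B * z)"
        by (simp add: N_def mat_ring)
      finally show ?thesis .
    qed
    then have NY: "N Y = N X - N X * (B * z) * (g * N X)"
      by (intro eq_matI) (auto simp: N_def[of X] N_def[of Y])
    have "g * N X * (B * z) = 1\<^sub>m 1" using gz(3) by (simp add: mat_ring)
    then have less: "rk (N Y) < rk (N X)"
      unfolding NY using gz B Nc by (intro rk_wedderburn[of _ p p]) simp_all
    have "rk (B * Y) \<le> rk (B * X) + rk (N X * (B * z) * (g * N X))"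
      unfolding BY by (rule rk_add_le[of _ p p]) (simp_all add: carrier_matI)
    also have "\<dots> \<le> rk (B * X) + 1"
      using rk_outer_product_le[of "N X * (B * z)" p "g * N X" p] by (simp add: carrier_matI)
    finally have "good Y" using Yc Xr less by (simp add: good_def N_def)
    then show False using min[of Y] less by simp
  qed
  have "B - B * X * B = 0\<^sub>m p b" using NB by (simp add: N_def mat_ring)
  then have BXB: "B * X * B = B"
    using minus_mat_eq_zero_imp_eq[of B p b "B * X * B"] B by (simp add: carrier_matI)
  have "rk B \<le> rk (B * X)"
    using rk_mult_le(1)[of "B * X" p p B b] B Xc unfolding BXB by simp
  then show thesis
    using that[OF Xc] NB Xr by (simp add: N_def)
qed

text \<open>With \<open>N = 1 - B X\<close> from \<open>left_annihilator\<close>, the hypothesis gives \<open>A N = A\<close>, so \<open>rk A \<le> rk N \<le> p - rk B\<close>.\<close>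

lemma rk_add_le_of_mult_zero:
  fixes A B :: "'a::field mat"
  assumes A: "A \<in> carrier_mat n p" and B: "B \<in> carrier_mat p m" and AB: "A * B = 0\<^sub>m n m"
  shows "rk A + rk B \<le> p"
proof -
  obtain X where X: "X \<in> carrier_mat m p" "rk (1\<^sub>m p - B * X) + rk B \<le> p"
    using left_annihilator[OF B] by metis
  have "A * (1\<^sub>m p - B * X) = A - A * B * X"
    using A B X(1) by (simp add: mat_ring)
  also have "\<dots> = A"
    unfolding AB using A X(1) by (intro eq_matI) (auto simp: mat_ring)
  finally have "A * (1\<^sub>m p - B * X) = A" .
  moreover have "1\<^sub>m p - B * X \<in> carrier_mat p p"
    using B X(1) by (intro carrier_matI) simp_all
  ultimately have "rk A \<le> rk (1\<^sub>m p - B * X)"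
    using rk_mult_le(2)[OF A] by metis
  then show ?thesis using X(2) by simp
qed

section \<open>Blocks of the inverse\<close>

lemma four_block_mat_inject:
  assumes "A1 \<in> carrier_mat a b" "A2 \<in> carrier_mat a d" "A3 \<in> carrier_mat c b" "A4 \<in> carrier_mat c d"
    and "B1 \<in> carrier_mat a b" "B2 \<in> carrier_mat a d" "B3 \<in> carrier_mat c b" "B4 \<in> carrier_mat c d"
    and eq: "four_block_mat A1 A2 A3 A4 = four_block_mat B1 B2 B3 B4"
  shows "A1 = B1" "A2 = B2" "A3 = B3" "A4 = B4"
proof -
  note [simp] = assms(1-8)[THEN carrier_matD(1)] assms(1-8)[THEN carrier_matD(2)]
  have ix: "four_block_mat A1 A2 A3 A4 $$ (i, j) = four_block_mat B1 B2 B3 B4 $$ (i, j)" for i j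
    by (simp only: eq)
  show "A1 = B1"
  proof (rule eq_matI)
    fix i j assume "i < dim_row B1" "j < dim_col B1"
    then show "A1 $$ (i, j) = B1 $$ (i, j)" using ix[of i j] by simp
  qed simp_all
  show "A2 = B2"
  proof (rule eq_matI)
    fix i j assume "i < dim_row B2" "j < dim_col B2"
    then show "A2 $$ (i, j) = B2 $$ (i, j)" using ix[of i "b + j"] by simp
  qed simp_all
  show "A3 = B3"
  proof (rule eq_matI)
    fix i j assume "i < dim_row B3" "j < dim_col B3"
    then show "A3 $$ (i, j) = B3 $$ (i, j)" using ix[of "a + i" j] by simp
  qed simp_all
  show "A4 = B4"
  proof (rule eq_matI)
    fix i j assume "i < dim_row B4" "j < dim_col B4"
    then show "A4 $$ (i, j) = B4 $$ (i, j)" using ix[of "a + i" "b + j"] by simp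
  qed simp_all
qed

lemma det_nonzero_imp_inverse:
  fixes A :: "'a::field mat"
  assumes A: "A \<in> carrier_mat n n" and "det A \<noteq> 0"
  obtains W where "W \<in> carrier_mat n n" "A * W = 1\<^sub>m n" "W * A = 1\<^sub>m n"
  using det_non_zero_imp_unit[OF assms, of "()"] by (auto simp: Units_def ring_mat_def)

lemma obtain_block_inverse:
  fixes P1 P2 P3 P4 :: "'a::field mat"
  assumes P1: "P1 \<in> carrier_mat m m" and P2: "P2 \<in> carrier_mat m n"
    and P3: "P3 \<in> carrier_mat n m" and P4: "P4 \<in> carrier_mat n n"
    and det: "det (four_block_mat P1 P2 P3 P4) \<noteq> 0"
  obtains Q1 Q2 Q3 Q4 where
    "Q1 \<in> carrier_mat m m" "Q2 \<in> carrier_mat m n" "Q3 \<in> carrier_mat n m" "Q4 \<in> carrier_mat n n"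
    "P1 * Q1 + P2 * Q3 = 1\<^sub>m m" "P3 * Q1 + P4 * Q3 = 0\<^sub>m n m" "P3 * Q2 + P4 * Q4 = 1\<^sub>m n"
    "Q1 * P1 + Q2 * P3 = 1\<^sub>m m" "Q3 * P1 + Q4 * P3 = 0\<^sub>m n m" "Q3 * P2 + Q4 * P4 = 1\<^sub>m n"
proof -
  have "four_block_mat P1 P2 P3 P4 \<in> carrier_mat (m + n) (m + n)"
    using P1 P4 by simp
  then obtain Q where Q: "Q \<in> carrier_mat (m + n) (m + n)"
    and PQ: "four_block_mat P1 P2 P3 P4 * Q = 1\<^sub>m (m + n)"
    and QP: "Q * four_block_mat P1 P2 P3 P4 = 1\<^sub>m (m + n)"
    using det by (rule det_nonzero_imp_inverse)
  obtain Q1 Q2 Q3 Q4 where split: "split_block Q m m = (Q1, Q2, Q3, Q4)"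
    by (metis prod_cases4)
  have Qb: "Q1 \<in> carrier_mat m m" "Q2 \<in> carrier_mat m n" "Q3 \<in> carrier_mat n m"
    "Q4 \<in> carrier_mat n n" and Qf: "Q = four_block_mat Q1 Q2 Q3 Q4"
    using split_block[OF split, of n n] Q by auto
  note [simp] = P1 P2 P3 P4 Qb
  have one: "1\<^sub>m (m + n) = (four_block_mat (1\<^sub>m m) (0\<^sub>m m n) (0\<^sub>m n m) (1\<^sub>m n) :: 'a mat)"
    by simp
  have c: "A * B + C * D \<in> carrier_mat k l"
    if "A \<in> carrier_mat k i" "B \<in> carrier_mat i l" "C \<in> carrier_mat k j" "D \<in> carrier_mat j l"
    for A B C D :: "'a mat" and i j k l
    using that by simp
  have "four_block_mat (P1 * Q1 + P2 * Q3) (P1 * Q2 + P2 * Q4) (P3 * Q1 + P4 * Q3) (P3 * Q2 + P4 * Q4)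
      = four_block_mat (1\<^sub>m m) (0\<^sub>m m n) (0\<^sub>m n m) (1\<^sub>m n)"
    using PQ unfolding Qf one by (subst (asm) mult_four_block_mat[OF P1 P2 P3 P4 Qb])
  note pq = four_block_mat_inject[OF c[OF P1 Qb(1) P2 Qb(3)] c[OF P1 Qb(2) P2 Qb(4)]
      c[OF P3 Qb(1) P4 Qb(3)] c[OF P3 Qb(2) P4 Qb(4)]
      one_carrier_mat zero_carrier_mat zero_carrier_mat one_carrier_mat this]
  have "four_block_mat (Q1 * P1 + Q2 * P3) (Q1 * P2 + Q2 * P4) (Q3 * P1 + Q4 * P3) (Q3 * P2 + Q4 * P4)
      = four_block_mat (1\<^sub>m m) (0\<^sub>m m n) (0\<^sub>m n m) (1\<^sub>m n)"
    using QP unfolding Qf one by (subst (asm) mult_four_block_mat[OF Qb P1 P2 P3 P4])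
  note qp = four_block_mat_inject[OF c[OF Qb(1) P1 Qb(2) P3] c[OF Qb(1) P2 Qb(2) P4]
      c[OF Qb(3) P1 Qb(4) P3] c[OF Qb(3) P2 Qb(4) P4]
      one_carrier_mat zero_carrier_mat zero_carrier_mat one_carrier_mat this]
  show thesis
    by (rule that[OF Qb pq(1,3,4) qp(1,3,4)])
qed

section \<open>Vectors that avoid two proper subspaces\<close>

lemma obtain_row_nonzero:
  fixes A :: "'a::field mat"
  assumes "A \<in> carrier_mat n m" "A \<noteq> 0\<^sub>m n m"
  obtains g where "g \<in> carrier_mat 1 n" "g * A \<noteq> 0\<^sub>m 1 m"
proof -
  obtain g z where gz: "g \<in> carrier_mat 1 n" "z \<in> carrier_mat m 1" "g * A * z = 1\<^sub>m 1"
    by (rule obtain_unit_entry[OF assms])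
  have "g * A \<noteq> 0\<^sub>m 1 m"
    using gz(2,3) zero_neq_one_mat[where 'a = 'a] left_mult_zero_mat[OF gz(2), of 1] by metis
  then show thesis using that gz(1) by blast
qed

lemma obtain_col_nonzero:
  fixes A :: "'a::field mat"
  assumes "A \<in> carrier_mat 1 m" "A \<noteq> 0\<^sub>m 1 m"
  obtains z where "z \<in> carrier_mat m 1" "A * z \<noteq> 0\<^sub>m 1 1"
proof -
  obtain g z where gz: "g \<in> carrier_mat 1 1" "z \<in> carrier_mat m 1" "g * A * z = 1\<^sub>m 1"
    by (rule obtain_unit_entry[OF assms])
  have "A * z \<noteq> 0\<^sub>m 1 1"
    using gz zero_neq_one_mat[where 'a = 'a] right_mult_zero_mat[OF gz(1), of 1]
      assoc_mult_mat[OF gz(1) assms(1) gz(2)] by metis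
  then show thesis using that gz(2) by blast
qed

text \<open>A group is not the union of two proper subgroups, in the form: if \<open>a\<close> avoids \<open>U\<close> and \<open>b\<close> avoids \<open>W\<close>,
then one of \<open>a\<close>, \<open>b\<close> and their sum \<open>s\<close> avoids both. Two being few enough, this works over every
field, including the field with two elements.\<close>

lemma not_covered_by_two_subgroups:
  assumes "\<not> U a" "\<not> W b" "U s \<Longrightarrow> U b \<Longrightarrow> U a" "W s \<Longrightarrow> W a \<Longrightarrow> W b"
  obtains c where "c \<in> {a, b, s}" "\<not> U c" "\<not> W c"
  using assms by blast

lemma obtain_col_both_nonzero:
  fixes A B :: "'a::field mat"
  assumes A: "A \<in> carrier_mat 1 m" "A \<noteq> 0\<^sub>m 1 m" and B: "B \<in> carrier_mat 1 m" "B \<noteq> 0\<^sub>m 1 m"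
  obtains y where "y \<in> carrier_mat m 1" "A * y \<noteq> 0\<^sub>m 1 1" "B * y \<noteq> 0\<^sub>m 1 1"
proof -
  obtain a where a: "a \<in> carrier_mat m 1" "A * a \<noteq> 0\<^sub>m 1 1" by (rule obtain_col_nonzero[OF A])
  obtain b where b: "b \<in> carrier_mat m 1" "B * b \<noteq> 0\<^sub>m 1 1" by (rule obtain_col_nonzero[OF B])
  have add: "C * (a + b) = C * a + C * b" "C * a \<in> carrier_mat 1 1" "C * b \<in> carrier_mat 1 1"
    if "C \<in> carrier_mat 1 m" for C
    using that a(1) b(1) by (simp_all add: mult_add_distrib_mat)
  obtain c where c: "c \<in> {a, b, a + b}" "\<not> A * c = 0\<^sub>m 1 1" "\<not> B * c = 0\<^sub>m 1 1"
  proof (rule not_covered_by_two_subgroups[of "\<lambda>y. A * y = 0\<^sub>m 1 1" a "\<lambda>y. B * y = 0\<^sub>m 1 1" b "a + b"])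
    show "A * a = 0\<^sub>m 1 1" if "A * (a + b) = 0\<^sub>m 1 1" "A * b = 0\<^sub>m 1 1"
      using that add[OF A(1)] right_add_zero_mat by metis
    show "B * b = 0\<^sub>m 1 1" if "B * (a + b) = 0\<^sub>m 1 1" "B * a = 0\<^sub>m 1 1"
      using that add[OF B(1)] left_add_zero_mat by metis
  qed (use a(2) b(2) in simp_all)
  have "c \<in> carrier_mat m 1"
    using c(1) a(1) b(1) add_carrier_mat[OF b(1), of a] by blast
  then show thesis using c(2,3) by (rule that)
qed

lemma scalar_mat_mult_eq_zero:
  fixes a b :: "'a::field mat"
  assumes a: "a \<in> carrier_mat 1 1" and b: "b \<in> carrier_mat 1 1" "b \<noteq> 0\<^sub>m 1 1" and ab: "a * b = 0\<^sub>m 1 1"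
  shows "a = 0\<^sub>m 1 1"
proof -
  obtain k where k: "k \<cdot>\<^sub>m b = 1\<^sub>m 1" by (rule scalar_mat_inverse[OF b])
  have "a = a * (k \<cdot>\<^sub>m b)" unfolding k using right_mult_one_mat[OF a] by simp
  also have "\<dots> = k \<cdot>\<^sub>m (a * b)" by (rule mult_smult_distrib[OF a b(1)])
  also have "\<dots> = 0\<^sub>m 1 1" unfolding ab by (intro eq_matI) auto
  finally show ?thesis .
qed

lemma obtain_col_normalized:
  fixes A B y :: "'a::field mat"
  assumes A: "A \<in> carrier_mat 1 m" and B: "B \<in> carrier_mat 1 m" and y: "y \<in> carrier_mat m 1"
    and "A * y \<noteq> 0\<^sub>m 1 1" "B * y \<noteq> 0\<^sub>m 1 1"
  obtains y' where "y' \<in> carrier_mat m 1" "A * y' = 1\<^sub>m 1" "B * y' \<noteq> 0\<^sub>m 1 1"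
proof -
  obtain k where k: "k \<cdot>\<^sub>m (A * y) = 1\<^sub>m 1"
    using scalar_mat_inverse[of "A * y"] A y assms(4) by (metis mult_carrier_mat)
  have "k \<noteq> 0"
  proof
    assume "k = 0"
    then have "k \<cdot>\<^sub>m (A * y) = 0\<^sub>m 1 1" using A y by (intro eq_matI) auto
    then show False using k zero_neq_one_mat by metis
  qed
  have "k \<cdot>\<^sub>m (B * y) \<noteq> 0\<^sub>m 1 1"
  proof
    assume "k \<cdot>\<^sub>m (B * y) = 0\<^sub>m 1 1"
    then have "inverse k \<cdot>\<^sub>m (k \<cdot>\<^sub>m (B * y)) = inverse k \<cdot>\<^sub>m 0\<^sub>m 1 1" by simp
    also have "inverse k \<cdot>\<^sub>m (k \<cdot>\<^sub>m (B * y)) = B * y"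
      using \<open>k \<noteq> 0\<close> by (intro eq_matI) auto
    also have "inverse k \<cdot>\<^sub>m 0\<^sub>m 1 1 = (0\<^sub>m 1 1 :: 'a mat)" by (intro eq_matI) auto
    finally show False using assms(5) by simp
  qed
  then show thesis
    using that[of "k \<cdot>\<^sub>m y"] k mult_smult_distrib[OF A y, of k] mult_smult_distrib[OF B y, of k] y
    by simp
qed

section \<open>A common row of two blocks\<close>

text \<open>For two blocks stacked into a left invertible matrix, as \<open>P1\<close> over \<open>P3\<close>, a dimension count forces the
row spaces to intersect. The inverse produces common rows explicitly: from
\<open>X A + Y B = 1\<close> follow \<open>B X A = (1 - B Y) B\<close> and \<open>A Y B = (1 - A X) A\<close>, so every row of either matrix lies
in both row spaces. If both were zero, then \<open>A = A (X A)\<close>, and \<open>B (X A) = 0\<close> would give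
\<open>rk B + rk A \<le> rk B + rk (X A) \<le> m\<close>.\<close>

lemma row_spaces_meet:
  fixes A B :: "'a::field mat"
  assumes A: "A \<in> carrier_mat a m" and B: "B \<in> carrier_mat b m"
    and X: "X \<in> carrier_mat m a" and Y: "Y \<in> carrier_mat m b"
    and inv: "X * A + Y * B = 1\<^sub>m m" and large: "m < rk A + rk B"
  obtains v x where "v \<in> carrier_mat 1 a" "x \<in> carrier_mat 1 b" "v * A = x * B" "v * A \<noteq> 0\<^sub>m 1 m"
proof -
  note [simp] = carrier_matD[OF A] carrier_matD[OF B] carrier_matD[OF X] carrier_matD[OF Y]
  have split: "M * (X * A) + M * (Y * B) = M" if "dim_col M = m" for M
  proof -
    have "M * (X * A) + M * (Y * B) = M * (X * A + Y * B)"
      using that by (simp add: mat_ring)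
    then show ?thesis using that by (simp add: inv mat_ring)
  qed
  have BXAc: "B * (X * A) \<in> carrier_mat b m" and AYBc: "A * (Y * B) \<in> carrier_mat a m"
    by (intro carrier_matI; simp)+
  have cancel: "C = M - D" if "C + D = M" "C \<in> carrier_mat k l" "D \<in> carrier_mat k l" for C D M :: "'a mat" and k l
    using that(2,3) unfolding that(1)[symmetric] by (intro eq_matI) auto
  show thesis
  proof (cases "B * (X * A) = 0\<^sub>m b m")
    case False
    then obtain e where e: "e \<in> carrier_mat 1 b" "e * (B * (X * A)) \<noteq> 0\<^sub>m 1 m"
      by (rule obtain_row_nonzero[OF BXAc])
    note [simp] = carrier_matD[OF e(1)]
    have "e * B * (X * A) = e * B - e * B * (Y * B)"
      by (rule cancel[of _ _ _ 1 m, OF split]) (simp, (intro carrier_matI; simp)+)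
    then have "(e * B * X) * A = (e - e * B * Y) * B" by (simp add: mat_ring)
    then show thesis
    proof (rule that[rotated 2])
      show "e * B * X * A \<noteq> 0\<^sub>m 1 m" using e(2) by (simp add: mat_ring)
    qed (intro carrier_matI; simp)+
  next
    case BXA: True
    show thesis
    proof (cases "A * (Y * B) = 0\<^sub>m a m")
      case False
      then obtain e where e: "e \<in> carrier_mat 1 a" "e * (A * (Y * B)) \<noteq> 0\<^sub>m 1 m"
        by (rule obtain_row_nonzero[OF AYBc])
      note [simp] = carrier_matD[OF e(1)]
      have "e * A * (X * A) + e * A * (Y * B) = e * A"
        by (rule split) simp
      then have "e * A * (Y * B) + e * A * (X * A) = e * A"
        by (subst comm_add_mat[of _ 1 m]) (intro carrier_matI; simp)+
      then have "e * A * (Y * B) = e * A - e * A * (X * A)"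
        by (rule cancel[of _ _ _ 1 m]) (intro carrier_matI; simp)+
      then have eq: "(e - e * A * X) * A = (e * A * Y) * B" by (simp add: mat_ring)
      show thesis
      proof (rule that[OF _ _ eq])
        show "(e - e * A * X) * A \<noteq> 0\<^sub>m 1 m" unfolding eq using e(2) by (simp add: mat_ring)
      qed (intro carrier_matI; simp)+
    next
      case AYB: True
      have "A * (X * A) = A"
        using split[of A] right_add_zero_mat[of "A * (X * A)" a m] A X unfolding AYB by simp
      then have "rk A \<le> rk (X * A)"
        using rk_mult_le(2)[of A a m "X * A" m] A X by (metis mult_carrier_mat)
      moreover have "rk B + rk (X * A) \<le> m"
        by (rule rk_add_le_of_mult_zero[OF B _ BXA]) (intro carrier_matI; simp)
      ultimately show thesis using large by simp
    qed
  qed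
qed

section \<open>Rank-one shears of an invertible block matrix\<close>

text \<open>Since \<open>v A = x B\<close>, the correction \<open>B y v A\<close> is \<open>B y x B\<close> with \<open>x B y = 1\<close>, that is, a Wedderburn
reduction of \<open>B\<close>, although it is a multiple of \<open>A\<close>.\<close>

lemma rk_reduced_by_common_row:
  fixes A B :: "'a::field mat"
  assumes A: "A \<in> carrier_mat a m" and B: "B \<in> carrier_mat b m"
    and v: "v \<in> carrier_mat 1 a" and x: "x \<in> carrier_mat 1 b" and y: "y \<in> carrier_mat m 1"
    and eq: "v * A = x * B" and one: "v * A * y = 1\<^sub>m 1"
  shows "rk (B - B * y * v * A) < rk B"
proof -
  note [simp] = carrier_matD[OF A] carrier_matD[OF B] carrier_matD[OF v] carrier_matD[OF x] carrier_matD[OF y]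
  have "B * y * v * A = B * y * (v * A)" by (simp add: mat_ring)
  then show ?thesis
    using rk_wedderburn[OF B x y] one unfolding eq by simp
qed

text \<open>The case of a singular \<open>P4\<close>. Taking \<open>u = P3 y\<close> in the column space of \<open>P3\<close> never raises the rank of
\<open>P3\<close>. Fix kernel vectors \<open>g P4 = 0\<close> and \<open>P4 z = 0\<close>. The rank of \<open>P4\<close> grows as soon as \<open>g P3 y\<close> and
\<open>v P2 z\<close> are nonzero, and that of \<open>P3\<close> drops if moreover \<open>v P1\<close> is a row of the row space of \<open>P3\<close>
with \<open>v P1 y = 1\<close>. Each of these conditions can be met separately, by invertibility of the
whole matrix or by \<open>row_spaces_meet\<close>; for \<open>v\<close> and for \<open>y\<close> there are only two proper subspaces to avoid.\<close>

lemma shear_improves_both_blocks: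
  fixes P1 P2 P3 P4 :: "'a::field mat"
  assumes P1: "P1 \<in> carrier_mat m m" and P2: "P2 \<in> carrier_mat m n"
    and P3: "P3 \<in> carrier_mat n m" and P4: "P4 \<in> carrier_mat n n"
    and det: "det (four_block_mat P1 P2 P3 P4) \<noteq> 0" and sing: "rk P4 < n"
  obtains u v where "u \<in> carrier_mat n 1" "v \<in> carrier_mat 1 m"
    "rk P4 < rk (P4 - u * v * P2)" "rk (P3 - u * v * P1) \<le> rk P3"
    "m < rk P1 + rk P3 \<Longrightarrow> rk (P3 - u * v * P1) < rk P3"
proof -
  obtain Q1 Q2 Q3 Q4 where Q: "Q1 \<in> carrier_mat m m" "Q2 \<in> carrier_mat m n"
      "Q3 \<in> carrier_mat n m" "Q4 \<in> carrier_mat n n"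
    and PQ: "P1 * Q1 + P2 * Q3 = 1\<^sub>m m" "P3 * Q1 + P4 * Q3 = 0\<^sub>m n m" "P3 * Q2 + P4 * Q4 = 1\<^sub>m n"
    and QP: "Q1 * P1 + Q2 * P3 = 1\<^sub>m m" "Q3 * P1 + Q4 * P3 = 0\<^sub>m n m" "Q3 * P2 + Q4 * P4 = 1\<^sub>m n"
    by (rule obtain_block_inverse[OF P1 P2 P3 P4 det])
  obtain z where z: "z \<in> carrier_mat n 1" "z \<noteq> 0\<^sub>m n 1" "P4 * z = 0\<^sub>m n 1"
    by (rule singular_imp_right_kernel[OF P4 sing])
  obtain g where g: "g \<in> carrier_mat 1 n" "g \<noteq> 0\<^sub>m 1 n" "g * P4 = 0\<^sub>m 1 n"
    by (rule singular_imp_left_kernel[OF P4 sing])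
  note [simp] = carrier_matD[OF P1] carrier_matD[OF P2] carrier_matD[OF P3] carrier_matD[OF P4]
    carrier_matD[OF Q(1)] carrier_matD[OF Q(2)] carrier_matD[OF Q(3)] carrier_matD[OF Q(4)]
    carrier_matD[OF z(1)] carrier_matD[OF g(1)]
  have gP3c: "g * P3 \<in> carrier_mat 1 m" by (intro carrier_matI) simp_all
  have gP3: "g * P3 \<noteq> 0\<^sub>m 1 m"
  proof
    assume 0: "g * P3 = 0\<^sub>m 1 m"
    have "g = g * (P3 * Q2 + P4 * Q4)" unfolding PQ(3) by (simp add: mat_ring)
    also have "\<dots> = (g * P3) * Q2 + (g * P4) * Q4" by (simp add: mat_ring)
    also have "\<dots> = 0\<^sub>m 1 n" unfolding 0 g(3) by (simp add: mat_ring)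
    finally show False using g(2) by simp
  qed
  \<comment> \<open>the rows that \<open>P1\<close> maps into the row space of \<open>P3\<close>; all candidates for \<open>v\<close> are taken from here\<close>
  define S where "S v \<longleftrightarrow> v \<in> carrier_mat 1 m \<and> (\<exists>x\<in>carrier_mat 1 n. v * P1 = x * P3)" for v
  have S_add: "S (a + b)" if "S a" "S b" for a b
  proof -
    obtain x y where xy: "x \<in> carrier_mat 1 n" "a * P1 = x * P3" "y \<in> carrier_mat 1 n" "b * P1 = y * P3"
      and ab: "a \<in> carrier_mat 1 m" "b \<in> carrier_mat 1 m"
      using \<open>S a\<close> \<open>S b\<close> by (auto simp: S_def)
    have "(a + b) * P1 = (x + y) * P3"
      using add_mult_distrib_mat[OF ab P1] add_mult_distrib_mat[OF xy(1,3) P3] xy(2,4) by simp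
    then show ?thesis using xy(1,3) ab unfolding S_def by (metis add_carrier_mat)
  qed
  obtain b where b: "S b" "b * (P2 * z) \<noteq> 0\<^sub>m 1 1"
  proof -
    \<comment> \<open>the lower half \<open>(Q3, Q4)\<close> of the inverse maps the whole matrix to \<open>(0, 1)\<close>, so \<open>w Q3\<close> lies in \<open>S\<close> and \<open>w Q3 P2 z = w z\<close>\<close>
    obtain w where w: "w \<in> carrier_mat 1 n" "w * z \<noteq> 0\<^sub>m 1 1"
      by (rule obtain_row_nonzero[OF z(1,2)])
    note [simp] = carrier_matD[OF w(1)]
    have "w * (Q3 * P1) + w * (Q4 * P3) = w * (Q3 * P1 + Q4 * P3)" by (simp add: mat_ring)
    also have "\<dots> = 0\<^sub>m 1 m" unfolding QP(2) by (simp add: mat_ring)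
    finally have 0: "w * (Q3 * P1) + w * (Q4 * P3) = 0\<^sub>m 1 m" .
    have "(w * Q3) * P1 = (0\<^sub>m 1 n - w * Q4) * P3"
    proof (rule minus_mat_eq_zero_imp_eq[of _ 1 m])
      have "(w * Q3) * P1 - (0\<^sub>m 1 n - w * Q4) * P3 = w * (Q3 * P1) - (0\<^sub>m 1 m - w * (Q4 * P3))"
        by (simp add: mat_ring)
      also have "\<dots> = w * (Q3 * P1) + w * (Q4 * P3)" by (intro eq_matI) auto
      finally show "(w * Q3) * P1 - (0\<^sub>m 1 n - w * Q4) * P3 = 0\<^sub>m 1 m" unfolding 0 .
    qed (intro carrier_matI; simp)+
    moreover have "w * Q3 \<in> carrier_mat 1 m" "0\<^sub>m 1 n - w * Q4 \<in> carrier_mat 1 n"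
      by (intro carrier_matI; simp)+
    ultimately have "S (w * Q3)" unfolding S_def by blast
    have "w * (Q3 * (P2 * z)) = w * ((Q3 * P2 + Q4 * P4) * z) - w * (Q4 * (P4 * z))"
      by (intro eq_matI) (auto simp: mat_ring simp del: index_mult_mat(1))
    also have "\<dots> = w * z" unfolding QP(3) z(3) by (intro eq_matI) (auto simp: mat_ring)
    finally have "(w * Q3) * (P2 * z) \<noteq> 0\<^sub>m 1 1" using w(2) by (simp add: mat_ring)
    with \<open>S (w * Q3)\<close> show thesis by (rule that)
  qed
  have conv: "rk P4 < rk (P4 - (P3 * y) * v * P2)"
    if y: "y \<in> carrier_mat m 1" "g * P3 * y \<noteq> 0\<^sub>m 1 1" and v: "v \<in> carrier_mat 1 m" "v * (P2 * z) \<noteq> 0\<^sub>m 1 1"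
    for y v
  proof -
    note [simp] = carrier_matD[OF y(1)] carrier_matD[OF v(1)]
    have "rk P4 < rk (P4 - (P3 * y) * (v * P2))"
    proof (rule rk_wedderburn_converse[OF P4 _ _ g(1,3) _ z(1,3)])
      show "g * (P3 * y) \<noteq> 0\<^sub>m 1 1" using y(2) by (simp add: mat_ring)
      show "v * P2 * z \<noteq> 0\<^sub>m 1 1" using v(2) by (simp add: mat_ring)
    qed (intro carrier_matI; simp)+
    then show ?thesis by (simp add: mat_ring)
  qed
  show thesis
  proof (cases "m < rk P1 + rk P3")
    case True
    obtain a x0 where a: "a \<in> carrier_mat 1 m" "x0 \<in> carrier_mat 1 n" "a * P1 = x0 * P3" "a * P1 \<noteq> 0\<^sub>m 1 m"
      by (rule row_spaces_meet[OF P1 P3 Q(1,2) QP(1) True])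
    then have Sa: "S a" by (auto simp: S_def)
    have bc: "b \<in> carrier_mat 1 m" using b(1) by (simp add: S_def)
    have P2z: "P2 * z \<in> carrier_mat m 1" by (intro carrier_matI) simp_all
    obtain v where v: "v \<in> {a, b, a + b}" "\<not> v * P1 = 0\<^sub>m 1 m" "\<not> v * (P2 * z) = 0\<^sub>m 1 1"
    proof (rule not_covered_by_two_subgroups[of "\<lambda>v. v * P1 = 0\<^sub>m 1 m" a "\<lambda>v. v * (P2 * z) = 0\<^sub>m 1 1" b "a + b"])
      show "a * P1 = 0\<^sub>m 1 m" if "(a + b) * P1 = 0\<^sub>m 1 m" "b * P1 = 0\<^sub>m 1 m"
        using that add_mult_distrib_mat[OF a(1) bc P1] right_add_zero_mat[OF mult_carrier_mat[OF a(1) P1]] by metis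
      show "b * (P2 * z) = 0\<^sub>m 1 1" if "(a + b) * (P2 * z) = 0\<^sub>m 1 1" "a * (P2 * z) = 0\<^sub>m 1 1"
        using that add_mult_distrib_mat[OF a(1) bc P2z] left_add_zero_mat[OF mult_carrier_mat[OF bc P2z]] by metis
    qed (use a(4) b(2) in simp_all)
    have "S v" using v(1) Sa b(1) S_add by auto
    then obtain x where vc: "v \<in> carrier_mat 1 m" and x: "x \<in> carrier_mat 1 n" "v * P1 = x * P3"
      by (auto simp: S_def)
    have vP1: "v * P1 \<in> carrier_mat 1 m" using vc P1 by simp
    obtain y0 where y0: "y0 \<in> carrier_mat m 1" "v * P1 * y0 \<noteq> 0\<^sub>m 1 1" "g * P3 * y0 \<noteq> 0\<^sub>m 1 1"
      by (rule obtain_col_both_nonzero[OF vP1 v(2) gP3c gP3])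
    obtain y where y: "y \<in> carrier_mat m 1" "v * P1 * y = 1\<^sub>m 1" "g * P3 * y \<noteq> 0\<^sub>m 1 1"
      by (rule obtain_col_normalized[OF vP1 gP3c y0])
    have "rk (P3 - P3 * y * v * P1) < rk P3"
      by (rule rk_reduced_by_common_row[OF P1 P3 vc x(1) y(1) x(2) y(2)])
    then show thesis
      using that[of "P3 * y" v] conv[OF y(1,3) vc v(3)] vc P3 y(1) by simp
  next
    case False
    have bc: "b \<in> carrier_mat 1 m" using b(1) by (simp add: S_def)
    obtain y where y: "y \<in> carrier_mat m 1" "g * P3 * y \<noteq> 0\<^sub>m 1 1"
      by (rule obtain_col_nonzero[OF gP3c gP3])
    note [simp] = carrier_matD[OF y(1)] carrier_matD[OF bc]
    have "P3 - P3 * y * b * P1 = P3 * (1\<^sub>m m - y * (b * P1))"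
      by (simp add: mat_ring)
    moreover have "rk (P3 * (1\<^sub>m m - y * (b * P1))) \<le> rk P3"
      by (rule rk_mult_le(1)[OF P3, of _ m]) (intro carrier_matI; simp)
    ultimately have "rk (P3 - P3 * y * b * P1) \<le> rk P3" by simp
    moreover have "P3 * y \<in> carrier_mat n 1" by (intro carrier_matI) simp_all
    ultimately show thesis
      using that[of "P3 * y" b] conv[OF y bc b(2)] bc False by blast
  qed
qed

text \<open>The case of an invertible \<open>P4\<close>, which the shear must not spoil. Let \<open>W\<close> be the inverse of \<open>P4\<close> and
\<open>C = P1 - P2 W P3\<close> its Schur complement, which is invertible with inverse \<open>Q1\<close>. With \<open>u = P3 y\<close> and
\<open>v P1 y = 1\<close>, the matrix \<open>P4 - u v P2\<close> is singular only if \<open>v P2 W u = 1\<close>, and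
\<open>v P2 W u = 1 - v C y\<close>. So \<open>y\<close> has to avoid the zeros of the two nonzero rows \<open>v P1\<close> and \<open>v C\<close>.\<close>

lemma shear_keeps_corner_invertible:
  fixes P1 P2 P3 P4 :: "'a::field mat"
  assumes P1: "P1 \<in> carrier_mat m m" and P2: "P2 \<in> carrier_mat m n"
    and P3: "P3 \<in> carrier_mat n m" and P4: "P4 \<in> carrier_mat n n"
    and det: "det (four_block_mat P1 P2 P3 P4) \<noteq> 0" and full: "rk P4 = n"
    and large: "m < rk P1 + rk P3"
  obtains u v where "u \<in> carrier_mat n 1" "v \<in> carrier_mat 1 m"
    "rk (P4 - u * v * P2) = n" "rk (P3 - u * v * P1) < rk P3"
proof -
  obtain Q1 Q2 Q3 Q4 where Q: "Q1 \<in> carrier_mat m m" "Q2 \<in> carrier_mat m n"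
      "Q3 \<in> carrier_mat n m" "Q4 \<in> carrier_mat n n"
    and PQ: "P1 * Q1 + P2 * Q3 = 1\<^sub>m m" "P3 * Q1 + P4 * Q3 = 0\<^sub>m n m" "P3 * Q2 + P4 * Q4 = 1\<^sub>m n"
    and QP: "Q1 * P1 + Q2 * P3 = 1\<^sub>m m" "Q3 * P1 + Q4 * P3 = 0\<^sub>m n m" "Q3 * P2 + Q4 * P4 = 1\<^sub>m n"
    by (rule obtain_block_inverse[OF P1 P2 P3 P4 det])
  obtain W where W: "W \<in> carrier_mat n n" "P4 * W = 1\<^sub>m n" "W * P4 = 1\<^sub>m n"
    using det_nonzero_imp_inverse[OF P4] rk_eq_dim_iff_det[OF P4] full by metis
  note [simp] = carrier_matD[OF P1] carrier_matD[OF P2] carrier_matD[OF P3] carrier_matD[OF P4]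
    carrier_matD[OF Q(1)] carrier_matD[OF Q(2)] carrier_matD[OF Q(3)] carrier_matD[OF Q(4)]
    carrier_matD[OF W(1)]
  define C where "C = P1 - P2 * (W * P3)"
  have Cc: "C \<in> carrier_mat m m" unfolding C_def by (intro carrier_matI) simp_all
  note [simp] = carrier_matD[OF Cc]
  have CQ: "C * Q1 = 1\<^sub>m m"
  proof -
    have "W * (P3 * Q1) + Q3 = W * (P3 * Q1) + (W * P4) * Q3" unfolding W(3) by (simp add: mat_ring)
    also have "\<dots> = W * (P3 * Q1 + P4 * Q3)" by (simp add: mat_ring)
    also have "\<dots> = 0\<^sub>m n m" unfolding PQ(2) by (simp add: mat_ring)
    finally have 0: "W * (P3 * Q1) + Q3 = 0\<^sub>m n m" .
    have "C * Q1 = P1 * Q1 - P2 * (W * (P3 * Q1))" by (simp add: C_def mat_ring)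
    also have "\<dots> = P1 * Q1 + P2 * Q3 - P2 * (W * (P3 * Q1) + Q3)"
      by (intro eq_matI) (auto simp: mat_ring simp del: index_mult_mat(1))
    also have "\<dots> = 1\<^sub>m m" unfolding 0 PQ(1) by (intro eq_matI) (auto simp: mat_ring)
    finally show ?thesis .
  qed
  obtain v x where v: "v \<in> carrier_mat 1 m" and x: "x \<in> carrier_mat 1 n" "v * P1 = x * P3"
    and vP1: "v * P1 \<noteq> 0\<^sub>m 1 m"
    by (rule row_spaces_meet[OF P1 P3 Q(1,2) QP(1) large])
  note [simp] = carrier_matD[OF v] carrier_matD[OF x(1)]
  have c: "v * P1 \<in> carrier_mat 1 m" "v * C \<in> carrier_mat 1 m" by (intro carrier_matI; simp)+
  have vC: "v * C \<noteq> 0\<^sub>m 1 m"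
  proof
    assume 0: "v * C = 0\<^sub>m 1 m"
    have "v = v * (C * Q1)" unfolding CQ by (simp add: mat_ring)
    also have "\<dots> = (v * C) * Q1" by (simp add: mat_ring)
    also have "\<dots> = 0\<^sub>m 1 m" unfolding 0 by (simp add: mat_ring)
    finally have "v * P1 = 0\<^sub>m 1 m" by (simp add: mat_ring)
    then show False using vP1 by simp
  qed
  obtain y0 where y0: "y0 \<in> carrier_mat m 1" "v * P1 * y0 \<noteq> 0\<^sub>m 1 1" "v * C * y0 \<noteq> 0\<^sub>m 1 1"
    by (rule obtain_col_both_nonzero[OF c(1) vP1 c(2) vC])
  obtain y where y: "y \<in> carrier_mat m 1" "v * P1 * y = 1\<^sub>m 1" "v * C * y \<noteq> 0\<^sub>m 1 1"
    by (rule obtain_col_normalized[OF c y0])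
  note [simp] = carrier_matD[OF y(1)]
  have uc: "P3 * y \<in> carrier_mat n 1" by (intro carrier_matI) simp_all
  have less: "rk (P3 - P3 * y * v * P1) < rk P3"
    by (rule rk_reduced_by_common_row[OF P1 P3 v x(1) y(1) x(2) y(2)])
  define D where "D = P4 - P3 * y * v * P2"
  have Dc: "D \<in> carrier_mat n n" unfolding D_def by (intro carrier_matI) simp_all
  have "rk D = n"
  proof (rule ccontr)
    assume "rk D \<noteq> n"
    then have "rk D < n" using rk_le_dim(1)[OF Dc] by simp
    then obtain g where g: "g \<in> carrier_mat 1 n" "g \<noteq> 0\<^sub>m 1 n" "g * D = 0\<^sub>m 1 n"
      by (rule singular_imp_left_kernel[OF Dc])
    note [simp] = carrier_matD[OF g(1)]
    define k where "k = g * (P3 * y)"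
    have kc: "k \<in> carrier_mat 1 1" unfolding k_def by (intro carrier_matI) simp_all
    note [simp] = carrier_matD[OF kc]
    have gP4: "g * P4 = k * (v * P2)"
    proof (rule minus_mat_eq_zero_imp_eq[of _ 1 n])
      have "g * P4 - k * (v * P2) = g * D" by (simp add: D_def k_def mat_ring)
      then show "g * P4 - k * (v * P2) = 0\<^sub>m 1 n" using g(3) by simp
    qed (intro carrier_matI; simp)+
    have "g = (g * P4) * W" using W(2) by (simp add: mat_ring)
    then have gW: "g = k * (v * (P2 * W))" unfolding gP4 by (simp add: mat_ring)
    have "k * (v * C * y) = k * (v * P1 * y) - k * (v * (P2 * W)) * (P3 * y)"
      by (simp add: C_def mat_ring)
    also have "\<dots> = k * 1\<^sub>m 1 - k" unfolding y(2) gW[symmetric] by (simp add: k_def)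
    also have "\<dots> = 0\<^sub>m 1 1" by (intro eq_matI) (auto simp: mat_ring)
    finally have "k = 0\<^sub>m 1 1"
      by (intro scalar_mat_mult_eq_zero[OF kc _ y(3)]) (intro carrier_matI; simp)
    then have "g = 0\<^sub>m 1 n" unfolding gW by (simp add: mat_ring)
    then show False using g(2) by simp
  qed
  then show thesis using that[OF uc v] less by (simp add: D_def)
qed

section \<open>Factoring with prescribed ranks\<close>

text \<open>Induction on \<open>l\<close>. One rank-one shear \<open>D\<close>, subtracting \<open>D\<close> times the upper block row from the lower one,
re-establishes the rank hypotheses with \<open>l\<close> in place of \<open>Suc l\<close>, and \<open>L + D\<close> solves the given problem if
\<open>L\<close> solves the sheared one. For \<open>l = 0\<close> the block \<open>P4\<close> is invertible and \<open>R\<close>, its inverse times \<open>P3\<close>,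
has rank at most \<open>rk P3 \<le> r\<close>.\<close>

lemma low_rank_shears_exist:
  fixes P1 P2 P3 P4 :: "'a::field mat"
  assumes P1: "P1 \<in> carrier_mat m m" and P2: "P2 \<in> carrier_mat m n"
    and "P3 \<in> carrier_mat n m" "P4 \<in> carrier_mat n n"
    and "det (four_block_mat P1 P2 P3 P4) \<noteq> 0"
    and "n \<le> rk P4 + l" "m \<le> rk P1 + r" "rk P3 \<le> r + l"
  shows "\<exists>L\<in>carrier_mat n m. \<exists>R\<in>carrier_mat n m.
    P3 = L * P1 + (P4 - L * P2) * R \<and> rk L \<le> l \<and> rk R \<le> r"
  using assms(3-)
proof (induction l arbitrary: P3 P4)
  case 0
  note P3 = 0(1) and P4 = 0(2)
  note [simp] = carrier_matD[OF P1] carrier_matD[OF P2] carrier_matD[OF P3] carrier_matD[OF P4]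
  have "rk P4 = n" using 0(4) rk_le_dim(1)[OF P4] by simp
  then obtain W where W: "W \<in> carrier_mat n n" "P4 * W = 1\<^sub>m n"
    using det_nonzero_imp_inverse[OF P4] rk_eq_dim_iff_det[OF P4] by metis
  note [simp] = carrier_matD[OF W(1)]
  have WP3: "W * P3 \<in> carrier_mat n m" by (intro carrier_matI) simp_all
  have "0\<^sub>m n m * P1 + (P4 - 0\<^sub>m n m * P2) * (W * P3) = P4 * (W * P3)"
    by (intro eq_matI) (auto simp: mat_ring simp del: index_mult_mat(1))
  also have "\<dots> = (P4 * W) * P3" by (simp add: mat_ring)
  also have "\<dots> = P3" unfolding W(2) by (simp add: mat_ring)
  finally have "P3 = 0\<^sub>m n m * P1 + (P4 - 0\<^sub>m n m * P2) * (W * P3)" by simp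
  moreover have "rk (W * P3) \<le> r"
    using rk_mult_le(2)[OF W(1) P3] 0(6) by simp
  moreover have "rk (0\<^sub>m n m :: 'a mat) \<le> 0" by (simp add: rk_zero)
  ultimately show ?case using WP3 zero_carrier_mat by blast
next
  case (Suc l)
  note P3 = Suc.prems(1) and P4 = Suc.prems(2) and det = Suc.prems(3)
  note [simp] = carrier_matD[OF P1] carrier_matD[OF P2] carrier_matD[OF P3] carrier_matD[OF P4]
  obtain D where D: "D \<in> carrier_mat n m" "rk D \<le> 1" "n \<le> rk (P4 - D * P2) + l"
    "rk (P3 - D * P1) \<le> r + l"
  proof (cases "rk P4 < n")
    case True
    obtain u v where uv: "u \<in> carrier_mat n 1" "v \<in> carrier_mat 1 m"
      "rk P4 < rk (P4 - u * v * P2)" "rk (P3 - u * v * P1) \<le> rk P3"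
      "m < rk P1 + rk P3 \<Longrightarrow> rk (P3 - u * v * P1) < rk P3"
      by (rule shear_improves_both_blocks[OF P1 P2 P3 P4 det True]) blast
    \<comment> \<open>if the rank of \<open>P3\<close> need not drop, then \<open>rk P3 \<le> m - rk P1 \<le> r\<close> already\<close>
    have "rk (P3 - u * v * P1) \<le> r + l"
      using uv(4,5) Suc.prems(5,6) by linarith
    then show thesis
      using that[OF mult_carrier_mat[OF uv(1,2)] rk_outer_product_le[OF uv(1,2)]] uv(3) Suc.prems(4)
      by linarith
  next
    case False
    then have full: "rk P4 = n" using rk_le_dim(1)[OF P4] by simp
    show thesis
    proof (cases "m < rk P1 + rk P3")
      case True
      obtain u v where uv: "u \<in> carrier_mat n 1" "v \<in> carrier_mat 1 m"
        "rk (P4 - u * v * P2) = n" "rk (P3 - u * v * P1) < rk P3"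
        by (rule shear_keeps_corner_invertible[OF P1 P2 P3 P4 det full True])
      show thesis
        using that[OF mult_carrier_mat[OF uv(1,2)] rk_outer_product_le[OF uv(1,2)]] uv(3,4) Suc.prems(6)
        by linarith
    next
      case False
      have "P3 - 0\<^sub>m n m * P1 = P3" "P4 - 0\<^sub>m n m * P2 = P4"
        by (intro eq_matI; auto simp: mat_ring)+
      then show thesis
        using that[of "0\<^sub>m n m"] full False Suc.prems(5) by (simp add: rk_zero)
    qed
  qed
  note [simp] = carrier_matD[OF D(1)]
  have c: "P3 - D * P1 \<in> carrier_mat n m" "P4 - D * P2 \<in> carrier_mat n n"
    by (intro carrier_matI; simp)+
  \<comment> \<open>the shear multiplies by a matrix of determinant one and so preserves invertibility\<close>
  have E: "four_block_mat (1\<^sub>m m) (0\<^sub>m m n) (- D) (1\<^sub>m n) * four_block_mat P1 P2 P3 P4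
      = four_block_mat P1 P2 (P3 - D * P1) (P4 - D * P2)"
  proof -
    have "1\<^sub>m m * P1 + 0\<^sub>m m n * P3 = P1" "1\<^sub>m m * P2 + 0\<^sub>m m n * P4 = P2"
      by (intro eq_matI; auto simp: mat_ring)+
    moreover have "- D * P1 + 1\<^sub>m n * P3 = P3 - D * P1" "- D * P2 + 1\<^sub>m n * P4 = P4 - D * P2"
      using uminus_mult_left_mat[of D P1] uminus_mult_left_mat[of D P2]
      by (intro eq_matI; auto simp: mat_ring simp del: index_mult_mat(1))+
    ultimately show ?thesis
      by (subst mult_four_block_mat[OF one_carrier_mat zero_carrier_mat uminus_carrier_mat[OF D(1)]
            one_carrier_mat P1 P2 P3 P4]) simp
  qed
  have "det (four_block_mat P1 P2 (P3 - D * P1) (P4 - D * P2))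
      = det (four_block_mat (1\<^sub>m m) (0\<^sub>m m n) (- D) (1\<^sub>m n)) * det (four_block_mat P1 P2 P3 P4)"
    unfolding E[symmetric]
    by (rule det_mult[of _ "m + n"]) (use P1 P4 in simp_all)
  also have "det (four_block_mat (1\<^sub>m m) (0\<^sub>m m n) (- D) (1\<^sub>m n)) = 1"
    by (subst det_four_block_mat_upper_right_zero[OF one_carrier_mat refl uminus_carrier_mat[OF D(1)]
          one_carrier_mat]) simp
  finally have "det (four_block_mat P1 P2 (P3 - D * P1) (P4 - D * P2)) \<noteq> 0" using det by simp
  then obtain L R where L: "L \<in> carrier_mat n m" "rk L \<le> l" and R: "R \<in> carrier_mat n m" "rk R \<le> r"
    and eq: "P3 - D * P1 = L * P1 + (P4 - D * P2 - L * P2) * R"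
    using Suc.IH[OF c _ D(3) Suc.prems(5) D(4)] by blast
  note [simp] = carrier_matD[OF L(1)] carrier_matD[OF R(1)]
  have "P3 = (P3 - D * P1) + D * P1"
    by (intro eq_matI) (auto simp del: index_mult_mat(1))
  also have "\<dots> = (L + D) * P1 + (P4 - (L + D) * P2) * R"
    unfolding eq by (intro eq_matI) (auto simp: mat_ring simp del: index_mult_mat(1))
  finally have "P3 = (L + D) * P1 + (P4 - (L + D) * P2) * R" .
  moreover have "rk (L + D) \<le> Suc l"
    using rk_add_le[OF L(1) D(1)] L(2) D(2) by simp
  moreover have "L + D \<in> carrier_mat n m" using D(1) by simp
  ultimately show ?case using R by blast
qed

lemma shear_product:
  fixes L R C1 C2 C4 :: "'a::field mat"
  assumes L: "L \<in> carrier_mat n m" and R: "R \<in> carrier_mat n m" and C1: "C1 \<in> carrier_mat m m"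
    and C2: "C2 \<in> carrier_mat m n" and C4: "C4 \<in> carrier_mat n n"
  shows "four_block_mat (1\<^sub>m m) (0\<^sub>m m n) L (1\<^sub>m n) * four_block_mat C1 C2 (0\<^sub>m n m) C4
      * four_block_mat (1\<^sub>m m) (0\<^sub>m m n) R (1\<^sub>m n)
    = four_block_mat (C1 + C2 * R) C2 (L * C1 + (L * C2 + C4) * R) (L * C2 + C4)"
proof -
  note [simp] = carrier_matD[OF L] carrier_matD[OF R] carrier_matD[OF C1] carrier_matD[OF C2] carrier_matD[OF C4]
  have "1\<^sub>m m * C1 + 0\<^sub>m m n * 0\<^sub>m n m = C1" "1\<^sub>m m * C2 + 0\<^sub>m m n * C4 = C2"
    "L * C1 + 1\<^sub>m n * 0\<^sub>m n m = L * C1" "L * C2 + 1\<^sub>m n * C4 = L * C2 + C4"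
    by (intro eq_matI; auto simp: mat_ring simp del: index_mult_mat(1))+
  then have 1: "four_block_mat (1\<^sub>m m) (0\<^sub>m m n) L (1\<^sub>m n) * four_block_mat C1 C2 (0\<^sub>m n m) C4
      = four_block_mat C1 C2 (L * C1) (L * C2 + C4)"
    by (subst mult_four_block_mat[OF one_carrier_mat zero_carrier_mat L one_carrier_mat
          C1 C2 zero_carrier_mat C4]) simp
  have c: "L * C1 \<in> carrier_mat n m" "L * C2 + C4 \<in> carrier_mat n n" by (intro carrier_matI; simp)+
  have "C1 * 1\<^sub>m m + C2 * R = C1 + C2 * R" "C1 * 0\<^sub>m m n + C2 * 1\<^sub>m n = C2"
    "L * C1 * 1\<^sub>m m + (L * C2 + C4) * R = L * C1 + (L * C2 + C4) * R"
    "L * C1 * 0\<^sub>m m n + (L * C2 + C4) * 1\<^sub>m n = L * C2 + C4"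
    by (intro eq_matI; auto simp: mat_ring simp del: index_mult_mat(1))+
  then show ?thesis
    unfolding 1 by (subst mult_four_block_mat[OF C1 C2 c
          one_carrier_mat zero_carrier_mat R one_carrier_mat]) simp
qed

lemma dim_le_rk_add_of_det_diff:
  fixes A B :: "'a::field mat"
  assumes A: "A \<in> carrier_mat n n" and B: "B \<in> carrier_mat n n" and det: "det (A - B) \<noteq> 0"
  shows "n \<le> rk A + rk B"
proof -
  note [simp] = carrier_matD[OF A] carrier_matD[OF B]
  have c: "A - B \<in> carrier_mat n n" by (intro carrier_matI) simp_all
  have "A - B = A + B * (- 1\<^sub>m n)"
    using uminus_mult_right_mat[of B "1\<^sub>m n"]
    by (intro eq_matI) (auto simp: mat_ring simp del: index_mult_mat(1))
  then have "n = rk (A + B * (- 1\<^sub>m n))"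
    using det rk_eq_dim_iff_det[OF c] by simp
  also have "\<dots> \<le> rk A + rk (B * (- 1\<^sub>m n))"
    by (rule rk_add_le[OF A]) (intro carrier_matI; simp)
  also have "\<dots> \<le> rk A + rk B"
    using rk_mult_le(1)[OF B uminus_carrier_mat[OF one_carrier_mat]] by simp
  finally show ?thesis .
qed

text \<open>The existence lemma gives \<open>rk L \<le> l\<close> and \<open>rk R \<le> r\<close>. Equality is automatic: \<open>C1\<close> and \<open>C4\<close> are
invertible because \<open>P\<close> is, which bounds \<open>rk L\<close> below by \<open>n - rk P4\<close> and \<open>rk R\<close> below by \<open>m - rk P1\<close>, and
\<open>P3 = L P1 + C4 R\<close> bounds \<open>rk L + rk R\<close> below by \<open>rk P3\<close>. Together these bounds reach \<open>l + r\<close>.\<close>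

theorem theorem3:
  fixes P P\<^sub>1 P\<^sub>2 P\<^sub>3 P\<^sub>4 :: "'k::field mat"
    and m n l r :: nat
  assumes "P\<^sub>1 \<in> carrier_mat m m" and "P\<^sub>2 \<in> carrier_mat m n"
    and "P\<^sub>3 \<in> carrier_mat n m" and "P\<^sub>4 \<in> carrier_mat n n"
    and "P = four_block_mat P\<^sub>1 P\<^sub>2 P\<^sub>3 P\<^sub>4"
    and "invertible_mat P"
    and "int l \<ge> int n - int (rk P\<^sub>4)"
    and "int r \<ge> int m - int (rk P\<^sub>1)"
    and "int r + int l = max (int (rk P\<^sub>3)) (int n + int m - int (rk P\<^sub>4) - int (rk P\<^sub>1))"
  shows "\<exists>L R C\<^sub>1 C\<^sub>2 C\<^sub>4.
    L \<in> carrier_mat n m \<and> R \<in> carrier_mat n m \<and>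
    C\<^sub>1 \<in> carrier_mat m m \<and> C\<^sub>2 \<in> carrier_mat m n \<and> C\<^sub>4 \<in> carrier_mat n n \<and>
    P = four_block_mat (1\<^sub>m m) (0\<^sub>m m n) L (1\<^sub>m n)
        * four_block_mat C\<^sub>1 C\<^sub>2 (0\<^sub>m n m) C\<^sub>4
        * four_block_mat (1\<^sub>m m) (0\<^sub>m m n) R (1\<^sub>m n) \<and>
    rk L = l \<and> rk R = r"
proof -
  note P1 = assms(1) and P2 = assms(2) and P3 = assms(3) and P4 = assms(4) and P = assms(5)
  note [simp] = carrier_matD[OF P1] carrier_matD[OF P2] carrier_matD[OF P3] carrier_matD[OF P4]
  have Pc: "P \<in> carrier_mat (m + n) (m + n)" unfolding P using P1 P4 by simp
  have det: "det P \<noteq> 0"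
  proof -
    obtain Q where PQ: "P * Q = 1\<^sub>m (m + n)" and QP: "Q * P = 1\<^sub>m (dim_row Q)"
      using assms(6) Pc by (auto simp: invertible_mat_def inverts_mat_def)
    have "dim_col Q = m + n" using arg_cong[OF PQ, of dim_col] by simp
    moreover have "dim_row Q = m + n" using arg_cong[OF QP, of dim_col] Pc by simp
    ultimately have "det P * det Q = 1"
      using det_mult[OF Pc, of Q] PQ by (metis carrier_matI det_one)
    then show ?thesis by auto
  qed
  obtain L R where L: "L \<in> carrier_mat n m" "rk L \<le> l" and R: "R \<in> carrier_mat n m" "rk R \<le> r"
    and eq: "P\<^sub>3 = L * P\<^sub>1 + (P\<^sub>4 - L * P\<^sub>2) * R"
    using low_rank_shears_exist[OF P1 P2 P3 P4 det[unfolded P], of l r] assms(7-9) by fastforce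
  note [simp] = carrier_matD[OF L(1)] carrier_matD[OF R(1)]
  define C1 where "C1 = P\<^sub>1 - P\<^sub>2 * R"
  define C4 where "C4 = P\<^sub>4 - L * P\<^sub>2"
  have C1: "C1 \<in> carrier_mat m m" and C4: "C4 \<in> carrier_mat n n"
    unfolding C1_def C4_def by (intro carrier_matI; simp)+
  note [simp] = carrier_matD[OF C1] carrier_matD[OF C4]
  have "C1 + P\<^sub>2 * R = P\<^sub>1" "L * P\<^sub>2 + C4 = P\<^sub>4"
    by (intro eq_matI; auto simp: C1_def C4_def simp del: index_mult_mat(1))+
  moreover have "L * C1 + P\<^sub>4 * R = P\<^sub>3"
    by (subst eq, intro eq_matI) (auto simp: C1_def mat_ring simp del: index_mult_mat(1))
  ultimately have fact: "P = four_block_mat (1\<^sub>m m) (0\<^sub>m m n) L (1\<^sub>m n)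
        * four_block_mat C1 P\<^sub>2 (0\<^sub>m n m) C4 * four_block_mat (1\<^sub>m m) (0\<^sub>m m n) R (1\<^sub>m n)"
    unfolding shear_product[OF L(1) R(1) C1 P2 C4] P by simp
  have "det P = det C1 * det C4"
  proof -
    let ?E = "four_block_mat (1\<^sub>m m) (0\<^sub>m m n) L (1\<^sub>m n)"
    let ?C = "four_block_mat C1 P\<^sub>2 (0\<^sub>m n m) C4"
    let ?F = "four_block_mat (1\<^sub>m m) (0\<^sub>m m n) R (1\<^sub>m n)"
    have c: "?E \<in> carrier_mat (m + n) (m + n)" "?C \<in> carrier_mat (m + n) (m + n)"
      "?F \<in> carrier_mat (m + n) (m + n)"
      by (rule four_block_carrier_mat[OF one_carrier_mat one_carrier_mat]
          four_block_carrier_mat[OF C1 C4])+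
    have "det P = det ?E * det ?C * det ?F"
      unfolding fact det_mult[OF mult_carrier_mat[OF c(1,2)] c(3)] det_mult[OF c(1,2)] ..
    moreover have "det ?E = 1" "det ?F = 1"
      by (subst det_four_block_mat_upper_right_zero[OF one_carrier_mat refl _ one_carrier_mat];
          use L(1) R(1) in simp)+
    moreover have "det ?C = det C1 * det C4"
      by (rule det_four_block_mat_lower_left_zero[OF C1 P2 refl C4])
    ultimately show ?thesis by simp
  qed
  then have dets: "det C1 \<noteq> 0" "det C4 \<noteq> 0" using det by auto
  have nl: "n \<le> rk P\<^sub>4 + rk L"
    using dim_le_rk_add_of_det_diff[OF P4 mult_carrier_mat[OF L(1) P2]] dets(2) rk_mult_le(1)[OF L(1) P2]
    by (simp add: C4_def)
  have mr: "m \<le> rk P\<^sub>1 + rk R"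
    using dim_le_rk_add_of_det_diff[OF P1 mult_carrier_mat[OF P2 R(1)]] dets(1) rk_mult_le(2)[OF P2 R(1)]
    by (simp add: C1_def)
  have p3: "rk P\<^sub>3 \<le> rk L + rk R"
  proof -
    have "rk P\<^sub>3 \<le> rk (L * P\<^sub>1) + rk (C4 * R)"
      unfolding C4_def by (subst eq, rule rk_add_le[of _ n m]) (intro carrier_matI; simp)+
    also have "\<dots> \<le> rk L + rk R"
      using rk_mult_le(1)[OF L(1) P1] rk_mult_le(2)[OF C4 R(1)] by simp
    finally show ?thesis .
  qed
  have "rk L = l \<and> rk R = r"
    using nl mr p3 L(2) R(2) assms(9) by linarith
  then show ?thesis using L(1) R(1) C1 P2 C4 fact by blast
qed

end
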